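(* Let $\mathbf{A}=\langle A,\vee,\wedge,\ast,\to,\forall,\exists,0,1\rangle$ be a c-EBL-algebra with focal element $c$, and let $B=\exists A=\{\exists a: a\in A\}$. Then for every $a\in A$, $\forall a=\max\{b\in B: b\le c\to a\}$ and $\exists a=\min\{b\in B: c\ast a\le b\}$ (in particular these maximum and minimum exist).
   Context: A BL-algebra is an algebra $\langle A,\wedge,\vee,\ast,\to,0,1\rangle$ such that $\langle A,\wedge,\vee,0,1\rangle$ is a bounded lattice (order $\le$), $\langle A,\ast,1\rangle$ is a commutative monoid, $a\ast b\le c$ iff $a\le b\to c$, and $a\wedge b=a\ast(a\to b)$ and $(a\to b)\vee(b\to a)=1$ hold. An Epistemic BL-algebra (EBL-algebra) is a BL-algebra with unary operations $\forall,\exists$ satisfying, for all $a,b$: $\forall 1=1$; $\exists 0=0$; $\forall a\to\exists a=1$; $\forall(a\to\forall b)=\exists a\to\forall b$; $\forall(\forall a\to b)=\forall a\to\forall b$; $\exists a\to\forall\exists a=1$; $\forall(a\wedge b)=\forall a\wedge\forall b$; $\exists(a\vee b)=\exists a\vee\exists b$; $\exists(a\ast\exists b)=\exists a\ast\exists b$. If the set $\{a\in A:\forall a=1\}$ has a least element $c$, then $c$ is called the focal element of the EBL-algebra; a c-EBL-algebra is an EBL-algebra in which the focal element exists. (In any EBL-algebra, $\exists A=\forall A$ and it is a subalgebra.) *)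

theory Defs
  imports Main
begin

definition (in order) is_greatest :: "'a set \<Rightarrow> 'a \<Rightarrow> bool" where
  "is_greatest S m \<longleftrightarrow> m \<in> S \<and> (\<forall>x\<in>S. x \<le> m)"

definition (in order) is_least :: "'a set \<Rightarrow> 'a \<Rightarrow> bool" where
  "is_least S m \<longleftrightarrow> m \<in> S \<and> (\<forall>x\<in>S. m \<le> x)"

text \<open>The lattice top is identified with the monoid unit; the constant 0 of a
  BL-algebra is the lattice bottom.\<close>

class bl_algebra = bounded_lattice + comm_monoid_mult +
  fixes residuum :: "'a \<Rightarrow> 'a \<Rightarrow> 'a"  (infixr "\<leadsto>" 60)
  assumes top_eq_one: "top = 1"
    and residuation: "a * b \<le> c \<longleftrightarrow> a \<le> b \<leadsto> c"
    and divisibility: "inf a b = a * (a \<leadsto> b)"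
    and prelinearity: "sup (a \<leadsto> b) (b \<leadsto> a) = 1"

class ebl_algebra = bl_algebra +
  fixes univ :: "'a \<Rightarrow> 'a"  ("\<^bold>\<forall> _" [81] 80)
    and exis :: "'a \<Rightarrow> 'a"  ("\<^bold>\<exists> _" [81] 80)
  assumes univ_one: "\<^bold>\<forall> 1 = 1"
    and exis_zero: "\<^bold>\<exists> bot = bot"
    and univ_imp_exis: "(\<^bold>\<forall> a) \<leadsto> (\<^bold>\<exists> a) = 1"
    and univ_imp_univ: "\<^bold>\<forall> (a \<leadsto> (\<^bold>\<forall> b)) = (\<^bold>\<exists> a) \<leadsto> (\<^bold>\<forall> b)"
    and univ_univ_imp: "\<^bold>\<forall> ((\<^bold>\<forall> a) \<leadsto> b) = (\<^bold>\<forall> a) \<leadsto> (\<^bold>\<forall> b)"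
    and exis_imp_univ_exis: "(\<^bold>\<exists> a) \<leadsto> (\<^bold>\<forall> (\<^bold>\<exists> a)) = 1"
    and univ_inf: "\<^bold>\<forall> (inf a b) = inf (\<^bold>\<forall> a) (\<^bold>\<forall> b)"
    and exis_sup: "\<^bold>\<exists> (sup a b) = sup (\<^bold>\<exists> a) (\<^bold>\<exists> b)"
    and exis_mult_exis: "\<^bold>\<exists> (a * (\<^bold>\<exists> b)) = (\<^bold>\<exists> a) * (\<^bold>\<exists> b)"

definition (in ebl_algebra) focal_element :: "'a \<Rightarrow> bool" where
  "focal_element c \<longleftrightarrow> is_least {a. \<^bold>\<forall> a = 1} c"

class c_ebl_algebra = ebl_algebra +
  assumes focal_element_exists: "\<exists>c. focal_element c"

end

theory Submission
  imports Defs
begin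

text \<open>Since \<open>\<^bold>\<forall>\<close> is monotone, \<open>\<^bold>\<forall> x = 1\<close> holds exactly when \<open>c \<le> x\<close>. By residuation, for \<open>b\<close> in \<open>B\<close>
  (which is fixed by \<open>\<^bold>\<forall>\<close>), \<open>b \<le> c \<leadsto> a\<close> says \<open>\<^bold>\<forall> (b \<leadsto> a) = 1\<close> and \<open>c * a \<le> b\<close> says
  \<open>\<^bold>\<forall> (a \<leadsto> b) = 1\<close>. The axioms for \<open>\<^bold>\<forall> ((\<^bold>\<forall> b) \<leadsto> a)\<close> and \<open>\<^bold>\<forall> (a \<leadsto> (\<^bold>\<forall> b))\<close> turn these into
  \<open>b \<le> \<^bold>\<forall> a\<close> and \<open>\<^bold>\<exists> a \<le> b\<close>.\<close>

lemma (in bl_algebra) residuum_eq_one_iff: "a \<leadsto> b = 1 \<longleftrightarrow> a \<le> b"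
  by (metis residuation top_eq_one top_le top_greatest mult_1_left order_refl)

context ebl_algebra
begin

lemma univ_le_exis: "\<^bold>\<forall> a \<le> \<^bold>\<exists> a"
  using univ_imp_exis residuum_eq_one_iff by blast

lemma univ_mono: "a \<le> b \<Longrightarrow> \<^bold>\<forall> a \<le> \<^bold>\<forall> b"
  by (metis univ_inf inf.absorb_iff1)

lemma exis_one: "\<^bold>\<exists> 1 = 1"
  by (metis univ_le_exis univ_one top_eq_one top_le)

lemma exis_exis: "\<^bold>\<exists> (\<^bold>\<exists> a) = \<^bold>\<exists> a"
  using exis_mult_exis[of 1 a] by (simp add: exis_one)

text \<open>Together with \<open>exis_univ\<close> this makes the range of \<open>exis\<close> the
  set of fixed points of \<open>univ\<close>, so elements of \<open>B\<close> can stand where the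
  axioms ask for a \<open>univ\<close> term.\<close>

lemma univ_exis: "\<^bold>\<forall> (\<^bold>\<exists> a) = \<^bold>\<exists> a"
proof (rule order.antisym)
  show "\<^bold>\<forall> (\<^bold>\<exists> a) \<le> \<^bold>\<exists> a"
    using univ_le_exis[of "\<^bold>\<exists> a"] by (simp add: exis_exis)
  show "\<^bold>\<exists> a \<le> \<^bold>\<forall> (\<^bold>\<exists> a)"
    using exis_imp_univ_exis residuum_eq_one_iff by blast
qed

lemma one_residuum: "1 \<leadsto> a = a"
  by (metis divisibility inf_top_left mult_1_left top_eq_one)

lemma univ_univ: "\<^bold>\<forall> (\<^bold>\<forall> a) = \<^bold>\<forall> a"
  using univ_imp_univ[of 1 a] by (simp add: exis_one one_residuum)

lemma exis_univ: "\<^bold>\<exists> (\<^bold>\<forall> a) = \<^bold>\<forall> a"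
proof (rule order.antisym)
  show "\<^bold>\<exists> (\<^bold>\<forall> a) \<le> \<^bold>\<forall> a"
    \<comment> \<open>With \<open>univ a\<close> as antecedent, the left side of
      \<open>univ_imp_univ\<close> is \<open>univ 1 = 1\<close>.\<close>
    by (metis univ_imp_univ univ_one residuum_eq_one_iff order_refl)
  show "\<^bold>\<forall> a \<le> \<^bold>\<exists> (\<^bold>\<forall> a)"
    using univ_le_exis[of "\<^bold>\<forall> a"] by (simp add: univ_univ)
qed

lemma univ_eq_one_iff_focal_le:
  assumes "focal_element c"
  shows "\<^bold>\<forall> a = 1 \<longleftrightarrow> c \<le> a"
proof
  show "c \<le> a" if "\<^bold>\<forall> a = 1"
    using assms that by (simp add: focal_element_def is_least_def)
  show "\<^bold>\<forall> a = 1" if "c \<le> a"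
    using assms univ_mono[OF that] top_le
    by (simp add: focal_element_def is_least_def top_eq_one)
qed

lemma exis_le_focal_residuum_iff:
  assumes "focal_element c"
  shows "\<^bold>\<exists> b \<le> c \<leadsto> a \<longleftrightarrow> \<^bold>\<exists> b \<le> \<^bold>\<forall> a"
proof -
  \<comment> \<open>Both sides are residuated forms of \<open>c * exis b \<le> a\<close>.\<close>
  have "\<^bold>\<exists> b \<le> c \<leadsto> a \<longleftrightarrow> c \<le> \<^bold>\<exists> b \<leadsto> a"
    by (metis residuation mult.commute)
  also have "\<dots> \<longleftrightarrow> \<^bold>\<forall> (\<^bold>\<exists> b \<leadsto> a) = 1"
    using univ_eq_one_iff_focal_le[OF assms] by simp
  also have "\<dots> \<longleftrightarrow> \<^bold>\<exists> b \<le> \<^bold>\<forall> a"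
    using univ_univ_imp[of "\<^bold>\<exists> b" a] by (simp add: univ_exis residuum_eq_one_iff)
  finally show ?thesis .
qed

lemma focal_mult_le_exis_iff:
  assumes "focal_element c"
  shows "c * a \<le> \<^bold>\<exists> b \<longleftrightarrow> \<^bold>\<exists> a \<le> \<^bold>\<exists> b"
proof -
  have "c * a \<le> \<^bold>\<exists> b \<longleftrightarrow> \<^bold>\<forall> (a \<leadsto> \<^bold>\<exists> b) = 1"
    using univ_eq_one_iff_focal_le[OF assms] by (simp add: residuation)
  also have "\<dots> \<longleftrightarrow> \<^bold>\<exists> a \<le> \<^bold>\<exists> b"
    using univ_imp_univ[of a "\<^bold>\<exists> b"] by (simp add: univ_exis residuum_eq_one_iff)
  finally show ?thesis .
qed

end

theorem theorem7:
  fixes c :: "'a :: c_ebl_algebra" and B :: "'a set"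
  assumes "focal_element c"
    and "B = {\<^bold>\<exists> a | a. True}"
  shows "\<forall>a. is_greatest {b \<in> B. b \<le> c \<leadsto> a} (\<^bold>\<forall> a)
           \<and> is_least {b \<in> B. c * a \<le> b} (\<^bold>\<exists> a)"
proof (intro allI conjI)
  fix a
  have "\<^bold>\<forall> a \<in> B"
    unfolding assms(2) using exis_univ[of a, symmetric] by blast
  \<comment> \<open>Since \<open>univ a = exis (univ a)\<close>, the equivalence reduces this to
    reflexivity.\<close>
  moreover have "\<^bold>\<forall> a \<le> c \<leadsto> a"
    using exis_le_focal_residuum_iff[OF assms(1), of "\<^bold>\<forall> a" a] by (simp add: exis_univ)
  ultimately show "is_greatest {b \<in> B. b \<le> c \<leadsto> a} (\<^bold>\<forall> a)"
    using exis_le_focal_residuum_iff[OF assms(1)] by (auto simp: is_greatest_def assms(2))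
  \<comment> \<open>Membership is the equivalence at \<open>b = a\<close>; minimality is its forward
    direction.\<close>
  show "is_least {b \<in> B. c * a \<le> b} (\<^bold>\<exists> a)"
    using focal_mult_le_exis_iff[OF assms(1)] by (auto simp: is_least_def assms(2))
qed

end
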